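(* Let $F$ and $G$ be cumulative distribution functions on $\mathbb{R}$ with finite positive variances, and let $\rho_\ast$ and $\rho^\ast$ be the minimum and maximum correlation coefficients over all bivariate distributions with marginals $F$ and $G$. Let $\rho\in[\rho_\ast,\rho^\ast]$. Let $\phi,\psi$ be functions (algorithms) such that, for $U$ uniform on $(0,1)$, $\phi(U)\sim F$ and $\psi(U)\sim G$. Let $(X,Y)$ be the pair of random variables generated by the Algorithm (described in the context) with inputs $\phi,\psi,\rho$, and let $U'$ be as in the Algorithm ($U'=U$ if $\rho>0$, $U'=1-U$ otherwise). Then: (a) $X\sim F$, $Y\sim G$ and $\mathrm{cor}(X,Y)=\rho$, if $\rho/c^{\phi,\psi}(U,U')\leq 1$. (b) If $\phi=F^{-1}$ and $\psi=G^{-1}$, then: (i) $(X,Y)$ has the joint cumulative distribution function $H(x,y)$, where $$\text{for }\rho\ge 0:\quad H(x,y)=\frac{\rho}{\rho^\ast}H^\ast(x,y)+\Bigl(1-\frac{\rho}{\rho^\ast}\Bigr)F(x)G(y);$$ $$\text{for }\rho\le 0:\quad H(x,y)=\frac{\rho}{\rho_\ast}H_\ast(x,y)+\Bigl(1-\frac{\rho}{\rho_\ast}\Bigr)F(x)G(y).$$ (ii) The Algorithm is applicable for all $\rho$ with $\rho_\ast\le\rho\le\rho^\ast$; that is, for every such $\rho$ the condition $\rho/c^{\phi,\psi}(U,U')\le 1$ of part (a) holds, so that the output satisfies $X\sim F$, $Y\sim G$ and $\mathrm{cor}(X,Y)=\rho$.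
   Context: For random variables with finite positive variances, $\mathrm{cor}(X,Y)=\mathrm{cov}(X,Y)/(\sigma_X\sigma_Y)$. $X\sim F$ means that $X$ has cumulative distribution function (cdf) $F$. Let $\Pi(F,G)$ be the set of all bivariate cdfs with marginals $F$ and $G$. The numbers $\rho_\ast$ and $\rho^\ast$ are the minimum and maximum of the correlation coefficient over pairs $(X,Y)$ whose joint cdf lies in $\Pi(F,G)$. The Fréchet–Hoeffding bounds are $$H^\ast(x,y)=\min\{F(x),G(y)\},\qquad H_\ast(x,y)=\max\{0,F(x)+G(y)-1\}.$$ (By classical results of Hoeffding and Whitt, $H^\ast$ attains $\rho^\ast$ and is the cdf of $(F^{-1}(U),G^{-1}(U))$, and $H_\ast$ attains $\rho_\ast$ and is the cdf of $(F^{-1}(U),G^{-1}(1-U))$, for $U$ uniform.) Inverse distribution functions: $F^{-1}(y)=\inf\{x:F(x)\ge y\}$ and $G^{-1}(y)=\inf\{x:G(x)\ge y\}$. Let $m_F,\sigma_F$ and $m_G,\sigma_G$ be the means and standard deviations of $F$ and $G$. For (possibly dependent) random variables $U,V$, each uniform on $(0,1)$, define the real number $$c^{\phi,\psi}(U,V)=\frac{E[\phi(U)\psi(V)]-m_Fm_G}{\sigma_F\sigma_G}.$$ Algorithm (inputs $\phi,\psi,\rho$): Sample $U,V,W$ independently and uniformly on $(0,1)$. Let $X=\phi(U)$. If $\rho>0$ let $U'=U$; otherwise let $U'=1-U$. If $W<\rho/c^{\phi,\psi}(U,U')$ (where $c^{\phi,\psi}(U,U')$ is the deterministic number $(E[\phi(U)\psi(U')]-m_Fm_G)/(\sigma_F\sigma_G)$),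 let $Y=\psi(U')$; otherwise let $Y=\psi(V)$. Return $(X,Y)$.
   Formalization: In (a) the condition ρ/c ≤ 1 is supplemented by "ρ = 0 or ρ/c > 0" (so c ≠ 0 when ρ ≠ 0); otherwise (a) fails, e.g. φ=F^{-1}, ψ(u)=G^{-1}(1−u), ρ>0 gives ρ/c<0 and correlation 0. *)

theory Defs
  imports "HOL-Probability.Probability"
begin

definition is_cdf :: "(real \<Rightarrow> real) \<Rightarrow> bool" where
  "is_cdf F \<longleftrightarrow> mono F \<and> (\<forall>a. continuous (at_right a) F) \<and>
     (F \<longlongrightarrow> 0) at_bot \<and> (F \<longlongrightarrow> 1) at_top"

definition has_cdf :: "'w measure \<Rightarrow> ('w \<Rightarrow> real) \<Rightarrow> (real \<Rightarrow> real) \<Rightarrow> bool" where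
  "has_cdf M X F \<longleftrightarrow> X \<in> borel_measurable M \<and> cdf (distr M borel X) = F"

(* Moments of a cdf F are those of its Lebesgue-Stieltjes measure interval_measure F. *)

definition cdf_mean :: "(real \<Rightarrow> real) \<Rightarrow> real" where
  "cdf_mean F = (\<integral>x. x \<partial>interval_measure F)"

definition cdf_var :: "(real \<Rightarrow> real) \<Rightarrow> real" where
  "cdf_var F = (\<integral>x. (x - cdf_mean F)\<^sup>2 \<partial>interval_measure F)"

definition cdf_sd :: "(real \<Rightarrow> real) \<Rightarrow> real" where
  "cdf_sd F = sqrt (cdf_var F)"

(* The integrability condition is needed because the Bochner integral of a
   non-integrable function is 0. *)
definition finite_pos_variance :: "(real \<Rightarrow> real) \<Rightarrow> bool" where
  "finite_pos_variance F \<longleftrightarrow> integrable (interval_measure F) (\<lambda>x. x\<^sup>2) \<and> 0 < cdf_var F"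

definition cov :: "'w measure \<Rightarrow> ('w \<Rightarrow> real) \<Rightarrow> ('w \<Rightarrow> real) \<Rightarrow> real" where
  "cov M X Y = (\<integral>\<omega>. (X \<omega> - integral\<^sup>L M X) * (Y \<omega> - integral\<^sup>L M Y) \<partial>M)"

definition sd :: "'w measure \<Rightarrow> ('w \<Rightarrow> real) \<Rightarrow> real" where
  "sd M X = sqrt (prob_space.variance M X)"

definition cor :: "'w measure \<Rightarrow> ('w \<Rightarrow> real) \<Rightarrow> ('w \<Rightarrow> real) \<Rightarrow> real" where
  "cor M X Y = cov M X Y / (sd M X * sd M Y)"

definition joint_cdf :: "'w measure \<Rightarrow> ('w \<Rightarrow> real) \<Rightarrow> ('w \<Rightarrow> real) \<Rightarrow> real \<Rightarrow> real \<Rightarrow> real" where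
  "joint_cdf M X Y x y = measure M {\<omega> \<in> space M. X \<omega> \<le> x \<and> Y \<omega> \<le> y}"

definition plane_distribution :: "(real \<times> real) measure \<Rightarrow> bool" where
  "plane_distribution \<mu> \<longleftrightarrow> prob_space \<mu> \<and> sets \<mu> = sets borel"

(* The set of all bivariate cdfs with marginals F and G. *)
definition bivariate_cdfs :: "(real \<Rightarrow> real) \<Rightarrow> (real \<Rightarrow> real) \<Rightarrow> (real \<Rightarrow> real \<Rightarrow> real) set" where
  "bivariate_cdfs F G = {H. (\<exists>\<mu>. plane_distribution \<mu> \<and> H = joint_cdf \<mu> fst snd) \<and>
     (\<forall>x. ((\<lambda>y. H x y) \<longlongrightarrow> F x) at_top) \<and> (\<forall>y. ((\<lambda>x. H x y) \<longlongrightarrow> G y) at_top)}"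

(* A correlation depends only on the joint law, so it suffices to let (X, Y) be the
   coordinate pair under a law on the plane; this avoids quantifying over the type of
   the underlying probability space. *)
definition correlations :: "(real \<Rightarrow> real) \<Rightarrow> (real \<Rightarrow> real) \<Rightarrow> real set" where
  "correlations F G =
     {cor \<mu> fst snd | \<mu>. plane_distribution \<mu> \<and> joint_cdf \<mu> fst snd \<in> bivariate_cdfs F G}"

definition rho_min :: "(real \<Rightarrow> real) \<Rightarrow> (real \<Rightarrow> real) \<Rightarrow> real" where
  "rho_min F G = (LEAST r. r \<in> correlations F G)"

definition rho_max :: "(real \<Rightarrow> real) \<Rightarrow> (real \<Rightarrow> real) \<Rightarrow> real" where
  "rho_max F G = (GREATEST r. r \<in> correlations F G)"

definition frechet_upper :: "(real \<Rightarrow> real) \<Rightarrow> (real \<Rightarrow> real) \<Rightarrow> real \<Rightarrow> real \<Rightarrow> real" where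
  "frechet_upper F G x y = min (F x) (G y)"

definition frechet_lower :: "(real \<Rightarrow> real) \<Rightarrow> (real \<Rightarrow> real) \<Rightarrow> real \<Rightarrow> real \<Rightarrow> real" where
  "frechet_lower F G x y = max 0 (F x + G y - 1)"

(* Only meaningful for y strictly between 0 and 1, elsewhere the set may be empty or unbounded. *)
definition inv_cdf :: "(real \<Rightarrow> real) \<Rightarrow> real \<Rightarrow> real" where
  "inv_cdf F y = Inf {x. y \<le> F x}"

definition unif01 :: "real measure" where
  "unif01 = restrict_space lborel {0<..<1}"

(* U takes all its values in the open interval: measurability into unif01 includes
   U \<omega> \<in> {0<..<1} for every \<omega>. Hence \<phi> and \<psi> matter only there. *)
definition is_uniform :: "'w measure \<Rightarrow> ('w \<Rightarrow> real) \<Rightarrow> bool" where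
  "is_uniform M U \<longleftrightarrow> U \<in> M \<rightarrow>\<^sub>M unif01 \<and> distr M unif01 U = unif01"

definition c_coef :: "'w measure \<Rightarrow> (real \<Rightarrow> real) \<Rightarrow> (real \<Rightarrow> real) \<Rightarrow>
    (real \<Rightarrow> real) \<Rightarrow> (real \<Rightarrow> real) \<Rightarrow> ('w \<Rightarrow> real) \<Rightarrow> ('w \<Rightarrow> real) \<Rightarrow> real" where
  "c_coef M F G \<phi> \<psi> U V =
     ((\<integral>\<omega>. \<phi> (U \<omega>) * \<psi> (V \<omega>) \<partial>M) - cdf_mean F * cdf_mean G) / (cdf_sd F * cdf_sd G)"

definition alg_U' :: "real \<Rightarrow> ('w \<Rightarrow> real) \<Rightarrow> 'w \<Rightarrow> real" where
  "alg_U' \<rho> U \<omega> = (if \<rho> > 0 then U \<omega> else 1 - U \<omega>)"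

definition alg_X :: "(real \<Rightarrow> real) \<Rightarrow> ('w \<Rightarrow> real) \<Rightarrow> 'w \<Rightarrow> real" where
  "alg_X \<phi> U \<omega> = \<phi> (U \<omega>)"

definition alg_Y :: "'w measure \<Rightarrow> (real \<Rightarrow> real) \<Rightarrow> (real \<Rightarrow> real) \<Rightarrow> (real \<Rightarrow> real) \<Rightarrow>
    (real \<Rightarrow> real) \<Rightarrow> real \<Rightarrow> ('w \<Rightarrow> real) \<Rightarrow> ('w \<Rightarrow> real) \<Rightarrow> ('w \<Rightarrow> real) \<Rightarrow> 'w \<Rightarrow> real" where
  "alg_Y M F G \<phi> \<psi> \<rho> U V W \<omega> =
     (if W \<omega> < \<rho> / c_coef M F G \<phi> \<psi> U (alg_U' \<rho> U)
      then \<psi> (alg_U' \<rho> U \<omega>) else \<psi> (V \<omega>))"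

end

theory Submission
  imports Defs
begin

text \<open>Hoeffding's identity expresses the covariance of a coupling of F and G with joint cdf H as the
  Lebesgue integral of \<open>H s t - F s * G t\<close> over the plane. Hence the correlation is monotone in H and is
  multiplied by p when H is replaced by the mixture of H and the independent coupling with weights
  p and 1 - p. The output of the algorithm is such a mixture with \<open>p = \<rho> / c\<close>, which gives correlation
  \<open>p * c = \<rho>\<close>. For the inverse cdfs the mixed-in coupling attains a Frechet-Hoeffding bound, so
  by monotonicity c is the maximal or minimal correlation; non-degeneracy makes the integrand nonzero
  on a rectangle, so that c has the right strict sign and \<open>\<rho> / c\<close> lies in the unit interval.\<close>

section \<open>Laws and moments determined by a cdf\<close>

lemma is_cdf_interval_measure:
  assumes "is_cdf F"
  shows "real_distribution (interval_measure F)" "cdf (interval_measure F) = F"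
proof -
  have F: "\<And>x y. x \<le> y \<Longrightarrow> F x \<le> F y" "\<And>a. continuous (at_right a) F" "(F \<longlongrightarrow> 0) at_bot" "(F \<longlongrightarrow> 1) at_top"
    using assms by (auto simp: is_cdf_def mono_def)
  show "real_distribution (interval_measure F)"
    by (rule real_distribution_interval_measure) (fact F)+
  show "cdf (interval_measure F) = F"
    by (rule cdf_interval_measure) (fact F)+
qed

text \<open>A law on the line is determined by its cdf. This carries integrals of functions of
  \<open>X\<close> over to \<open>interval_measure F\<close>, where the moments of \<open>F\<close>
  are defined.\<close>

lemma distr_eq_interval_measure:
  assumes "prob_space M" "is_cdf F" "has_cdf M X F"
  shows "distr M borel X = interval_measure F"
proof (rule cdf_unique)
  interpret prob_space M by fact
  show "real_distribution (distr M borel X)"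
    using assms(3) by (auto simp: has_cdf_def)
  show "real_distribution (interval_measure F)"
    using assms(2) by (rule is_cdf_interval_measure)
  show "cdf (distr M borel X) = cdf (interval_measure F)"
    using assms(3) is_cdf_interval_measure(2)[OF assms(2)] by (simp add: has_cdf_def)
qed

lemma cdf_distr_eq:
  assumes "X \<in> borel_measurable M"
  shows "cdf (distr M borel X) x = measure M {\<omega> \<in> space M. X \<omega> \<le> x}"
  unfolding cdf_def2 using assms
  by (subst measure_distr) (auto intro!: arg_cong[where f = "measure M"])

lemma has_cdf_prob: "has_cdf M X F \<Longrightarrow> measure M {\<omega> \<in> space M. X \<omega> \<le> x} = F x"
  using cdf_distr_eq[of X M x] by (simp add: has_cdf_def)

lemma has_cdfI:
  assumes "X \<in> borel_measurable M" "\<And>x. measure M {\<omega> \<in> space M. X \<omega> \<le> x} = F x"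
  shows "has_cdf M X F"
  unfolding has_cdf_def using assms cdf_distr_eq[of X M] by (simp add: fun_eq_iff)

lemma prob_space_interval_measure: "is_cdf F \<Longrightarrow> prob_space (interval_measure F)"
  using is_cdf_interval_measure(1) by (simp add: real_distribution_def)

lemma has_cdf_interval_measure:
  assumes "is_cdf F"
  shows "has_cdf (interval_measure F) (\<lambda>x. x) F"
proof -
  have "distr (interval_measure F) borel (\<lambda>x. x) = interval_measure F"
    by (intro measure_eqI) (auto simp: emeasure_distr)
  then show ?thesis
    by (simp add: has_cdf_def is_cdf_interval_measure(2)[OF assms])
qed

lemma has_cdf_integral:
  fixes f :: "real \<Rightarrow> real"
  assumes "prob_space M" "is_cdf F" "has_cdf M X F" "f \<in> borel_measurable borel"
  shows "(\<integral>\<omega>. f (X \<omega>) \<partial>M) = (\<integral>x. f x \<partial>interval_measure F)"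
  using integral_distr[OF _ assms(4), of X M] assms(3)
  by (simp add: distr_eq_interval_measure[OF assms(1-3)] has_cdf_def)

lemma has_cdf_integrable:
  fixes f :: "real \<Rightarrow> real"
  assumes "prob_space M" "is_cdf F" "has_cdf M X F" "f \<in> borel_measurable borel"
  shows "integrable M (\<lambda>\<omega>. f (X \<omega>)) \<longleftrightarrow> integrable (interval_measure F) f"
  using integrable_distr_eq[OF _ assms(4), of X M] assms(3)
  by (simp add: distr_eq_interval_measure[OF assms(1-3)] has_cdf_def)

lemma has_cdf_square_integrable:
  assumes "prob_space M" "is_cdf F" "has_cdf M X F" "finite_pos_variance F"
  shows "integrable M (\<lambda>\<omega>. (X \<omega>)\<^sup>2)"
  using has_cdf_integrable[OF assms(1-3), of "\<lambda>x. x\<^sup>2"] assms(4)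
  by (simp add: finite_pos_variance_def)

lemma has_cdf_mean:
  assumes "prob_space M" "is_cdf F" "has_cdf M X F"
  shows "(\<integral>\<omega>. X \<omega> \<partial>M) = cdf_mean F"
  using has_cdf_integral[OF assms, of "\<lambda>x. x"] by (simp add: cdf_mean_def)

lemma has_cdf_sd:
  assumes "prob_space M" "is_cdf F" "has_cdf M X F"
  shows "sd M X = cdf_sd F"
  using has_cdf_integral[OF assms, of "\<lambda>x. (x - cdf_mean F)\<^sup>2"]
  by (simp add: sd_def cdf_sd_def cdf_var_def has_cdf_mean[OF assms])

lemma cdf_sd_pos: "finite_pos_variance F \<Longrightarrow> 0 < cdf_sd F"
  by (simp add: finite_pos_variance_def cdf_sd_def)

lemma (in prob_space) integrable_mult_of_squares:
  fixes X Y :: "'a \<Rightarrow> real"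
  assumes [measurable]: "X \<in> borel_measurable M" "Y \<in> borel_measurable M"
    and "integrable M (\<lambda>\<omega>. (X \<omega>)\<^sup>2)" "integrable M (\<lambda>\<omega>. (Y \<omega>)\<^sup>2)"
  shows "integrable M (\<lambda>\<omega>. X \<omega> * Y \<omega>)"
proof (rule Bochner_Integration.integrable_bound)
  show "integrable M (\<lambda>\<omega>. (X \<omega>)\<^sup>2 + (Y \<omega>)\<^sup>2)"
    using assms by auto
  have "\<bar>x * y\<bar> \<le> x\<^sup>2 + y\<^sup>2" for x y :: real
    using sum_squares_bound[of "\<bar>x\<bar>" "\<bar>y\<bar>"] mult_nonneg_nonneg[of "\<bar>x\<bar>" "\<bar>y\<bar>"]
    unfolding abs_mult power2_abs by linarith
  then show "AE \<omega> in M. norm (X \<omega> * Y \<omega>) \<le> norm ((X \<omega>)\<^sup>2 + (Y \<omega>)\<^sup>2)"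
    by (intro AE_I2) (auto intro: order_trans)
qed auto

lemma has_cdf_mult_integrable:
  assumes "prob_space M" "is_cdf F" "has_cdf M X F" "finite_pos_variance F"
    and "is_cdf G" "has_cdf M Y G" "finite_pos_variance G"
  shows "integrable M (\<lambda>\<omega>. X \<omega> * Y \<omega>)"
  using assms has_cdf_square_integrable[of M F X] has_cdf_square_integrable[of M G Y]
  by (intro prob_space.integrable_mult_of_squares) (simp_all add: has_cdf_def)

lemma has_cdf_imp_integrable:
  assumes "prob_space M" "is_cdf F" "has_cdf M X F" "finite_pos_variance F"
  shows "integrable M X"
proof -
  interpret prob_space M by fact
  have "X \<in> borel_measurable M"
    using assms(3) by (simp add: has_cdf_def)
  then show ?thesis
    using has_cdf_square_integrable[OF assms] by (rule square_integrable_imp_integrable)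
qed

text \<open>The right-hand side has the shape of \<open>c_coef\<close>, so the constant computed by
  the algorithm is a genuine correlation, that of \<open>\<phi>\<close> at \<open>U\<close> and
  \<open>\<psi>\<close> at \<open>alg_U' \<rho> U\<close>.\<close>

lemma cor_eq:
  assumes M: "prob_space M"
    and F: "is_cdf F" "has_cdf M X F" "finite_pos_variance F"
    and G: "is_cdf G" "has_cdf M Y G" "finite_pos_variance G"
  shows "cor M X Y = ((\<integral>\<omega>. X \<omega> * Y \<omega> \<partial>M) - cdf_mean F * cdf_mean G) / (cdf_sd F * cdf_sd G)"
proof -
  interpret prob_space M by fact
  have [simp]: "integrable M X" "integrable M Y" "integrable M (\<lambda>\<omega>. X \<omega> * Y \<omega>)"
    using has_cdf_imp_integrable[OF M F] has_cdf_imp_integrable[OF M G]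
      has_cdf_mult_integrable[OF M F G] by auto
  have "cov M X Y = (\<integral>\<omega>. X \<omega> * Y \<omega> - cdf_mean F * Y \<omega> - cdf_mean G * X \<omega> + cdf_mean F * cdf_mean G \<partial>M)"
    unfolding cov_def has_cdf_mean[OF M F(1,2)] has_cdf_mean[OF M G(1,2)]
    by (intro Bochner_Integration.integral_cong) (auto simp: algebra_simps)
  also have "\<dots> = (\<integral>\<omega>. X \<omega> * Y \<omega> \<partial>M) - cdf_mean F * cdf_mean G"
    by (simp add: has_cdf_mean[OF M F(1,2)] has_cdf_mean[OF M G(1,2)] prob_space)
  finally show ?thesis
    by (simp add: cor_def has_cdf_sd[OF M F(1,2)] has_cdf_sd[OF M G(1,2)])
qed

section \<open>Layer-cake formula for cross moments\<close>

text \<open>The cutoff \<open>k\<close> keeps the integrand integrable over the whole plane. Its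
  terms depend on the marginals at most, so they cancel when the formulas for two couplings of the
  same cdfs are subtracted.\<close>

lemma cross_moment_by_joint_cdf:
  assumes M: "prob_space M" and XF: "has_cdf M X F" and YG: "has_cdf M Y G"
    and XY: "integrable M (\<lambda>\<omega>. X \<omega> * Y \<omega>)"
  defines "k \<equiv> indicator {0..} :: real \<Rightarrow> real"
  shows "has_bochner_integral (lborel \<Otimes>\<^sub>M lborel)
    (\<lambda>(s, t). k s * k t - k s * G t - k t * F s + joint_cdf M X Y s t) (\<integral>\<omega>. X \<omega> * Y \<omega> \<partial>M)"
proof -
  interpret M: prob_space M by fact
  interpret Q: pair_sigma_finite lborel "lborel :: real measure" ..
  interpret MQ: pair_sigma_finite M "lborel \<Otimes>\<^sub>M (lborel :: real measure)" ..
  have [measurable]: "X \<in> borel_measurable M" "Y \<in> borel_measurable M"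
    using XF YG by (auto simp: has_cdf_def)
  \<comment> \<open>The half-open interval between 0 and \<open>x\<close>; the factor
    \<open>sgn x\<close> below records its orientation, so that the signed length is
    \<open>x\<close>.\<close>
  define A where "A x = (if 0 \<le> x then {0..<x} else {x..<0::real})" for x :: real
  have [measurable]: "A x \<in> sets borel" for x
    by (simp add: A_def)
  have A: "k s - indicator {x..} s = sgn x * indicator (A x) s" for x s :: real
    by (auto simp: k_def A_def indicator_def sgn_if)
  have emA: "emeasure lborel (A x) = ennreal \<bar>x\<bar>" for x
    by (auto simp: A_def)
  \<comment> \<open>Layer-cake kernel: \<open>k s - indicator {x..} s\<close> has integral x over s, so integrating f over (s, t)
    gives X Y, while its expectation only involves F, G and the joint cdf.\<close>
  define f where "f = (\<lambda>(\<omega>, s, t). (k s - indicator {X \<omega>..} s) * (k t - indicator {Y \<omega>..} t))"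
  have f_box: "f (\<omega>, p) = sgn (X \<omega>) * sgn (Y \<omega>) * indicator (A (X \<omega>) \<times> A (Y \<omega>)) p" for \<omega> p
    by (cases p) (simp add: f_def A indicator_times)
  have f_norm: "norm (f (\<omega>, p)) = \<bar>sgn (X \<omega>) * sgn (Y \<omega>)\<bar> * indicator (A (X \<omega>) \<times> A (Y \<omega>)) p" for \<omega> p
    by (simp add: f_box abs_mult)
  have emAA: "emeasure (lborel \<Otimes>\<^sub>M lborel) (A x \<times> A y) = ennreal (\<bar>x\<bar> * \<bar>y\<bar>)" for x y
    by (simp add: lborel.emeasure_pair_measure_Times emA ennreal_mult)
  then have intA: "integrable (lborel \<Otimes>\<^sub>M lborel) (indicator (A x \<times> A y) :: _ \<Rightarrow> real)"
    and mA: "measure (lborel \<Otimes>\<^sub>M lborel) (A x \<times> A y) = \<bar>x\<bar> * \<bar>y\<bar>" for x y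
    by (auto simp: measure_def integrable_indicator_iff)
  have f_meas[measurable]: "f \<in> borel_measurable (M \<Otimes>\<^sub>M (lborel \<Otimes>\<^sub>M lborel))"
    unfolding f_def k_def indicator_def atLeast_iff by measurable
  have int1: "(\<integral>p. f (\<omega>, p) \<partial>(lborel \<Otimes>\<^sub>M lborel)) = X \<omega> * Y \<omega>" for \<omega>
  proof -
    have "(\<integral>p. f (\<omega>, p) \<partial>(lborel \<Otimes>\<^sub>M lborel)) = sgn (X \<omega>) * sgn (Y \<omega>) * (\<bar>X \<omega>\<bar> * \<bar>Y \<omega>\<bar>)"
      unfolding f_box by (simp add: mA)
    also have "\<dots> = (sgn (X \<omega>) * \<bar>X \<omega>\<bar>) * (sgn (Y \<omega>) * \<bar>Y \<omega>\<bar>)"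
      by (simp only: ac_simps)
    finally show ?thesis
      by (simp add: sgn_mult_abs)
  qed
  \<comment> \<open>For fixed \<omega> the kernel has constant sign on its box, so its absolute
    integral is that of the cross moment; integrability of \<open>X * Y\<close> is then what
    Fubini's theorem asks for.\<close>
  have int2: "(\<integral>p. norm (f (\<omega>, p)) \<partial>(lborel \<Otimes>\<^sub>M lborel)) = \<bar>X \<omega> * Y \<omega>\<bar>" for \<omega>
    unfolding f_norm by (simp add: mA abs_mult sgn_if)
  have int_f: "integrable (M \<Otimes>\<^sub>M (lborel \<Otimes>\<^sub>M lborel)) f"
  proof (rule MQ.Fubini_integrable)
    show "integrable M (\<lambda>\<omega>. \<integral>p. norm (f (\<omega>, p)) \<partial>(lborel \<Otimes>\<^sub>M lborel))"
      unfolding int2 using XY by simp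
    show "AE \<omega> in M. integrable (lborel \<Otimes>\<^sub>M lborel) (\<lambda>p. f (\<omega>, p))"
      unfolding f_box by (intro AE_I2 integrable_mult_right intA)
  qed simp
  \<comment> \<open>As a function of \<omega>, \<open>indicator {X \<omega>..} s\<close> is the
    indicator of the event \<open>X \<omega> \<le> s\<close>; expanding the product leaves the
    probabilities of two such events and of their intersection.\<close>
  have int3: "(\<integral>\<omega>. f (\<omega>, (s, t)) \<partial>M) = k s * k t - k s * G t - k t * F s + joint_cdf M X Y s t" for s t
  proof -
    define S T where "S = {\<omega> \<in> space M. X \<omega> \<le> s}" and "T = {\<omega> \<in> space M. Y \<omega> \<le> t}"
    have [measurable]: "S \<in> sets M" "T \<in> sets M"
      by (auto simp: S_def T_def)
    have "(\<integral>\<omega>. f (\<omega>, (s, t)) \<partial>M)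
        = (\<integral>\<omega>. k s * k t - k s * indicator T \<omega> - k t * indicator S \<omega> + indicator (S \<inter> T) \<omega> \<partial>M)"
      by (intro Bochner_Integration.integral_cong)
         (auto simp: f_def S_def T_def indicator_def algebra_simps)
    also have "\<dots> = k s * k t - k s * M.prob T - k t * M.prob S + M.prob (S \<inter> T)"
      by (simp add: M.prob_space M.emeasure_eq_measure)
    also have "S \<inter> T = {\<omega> \<in> space M. X \<omega> \<le> s \<and> Y \<omega> \<le> t}"
      by (auto simp: S_def T_def)
    finally show ?thesis
      by (simp add: S_def T_def joint_cdf_def has_cdf_prob[OF XF] has_cdf_prob[OF YG])
  qed
  have "has_bochner_integral (lborel \<Otimes>\<^sub>M lborel) (\<lambda>p. \<integral>\<omega>. f (\<omega>, p) \<partial>M)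
      (\<integral>p. (\<integral>\<omega>. f (\<omega>, p) \<partial>M) \<partial>(lborel \<Otimes>\<^sub>M lborel))"
    using MQ.integrable_snd[of "\<lambda>\<omega> p. f (\<omega>, p)"] int_f
    by (intro has_bochner_integral_integrable) simp
  also have "(\<integral>p. (\<integral>\<omega>. f (\<omega>, p) \<partial>M) \<partial>(lborel \<Otimes>\<^sub>M lborel)) = (\<integral>\<omega>. X \<omega> * Y \<omega> \<partial>M)"
    using MQ.Fubini_integral[of "\<lambda>\<omega> p. f (\<omega>, p)"] int_f by (simp add: int1)
  also have "(\<lambda>p. \<integral>\<omega>. f (\<omega>, p) \<partial>M)
      = (\<lambda>(s, t). k s * k t - k s * G t - k t * F s + joint_cdf M X Y s t)"
    by (auto simp: int3)
  finally show ?thesis .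
qed

section \<open>Frechet-Hoeffding bounds and marginals of joint cdfs\<close>

lemma is_cdf_bounds:
  assumes "is_cdf F"
  shows "0 \<le> F x" "F x \<le> 1"
proof -
  interpret real_distribution "interval_measure F"
    using assms by (rule is_cdf_interval_measure)
  show "0 \<le> F x" "F x \<le> 1"
    using cdf_nonneg[of x] cdf_bounded_prob[of x] is_cdf_interval_measure(2)[OF assms] by simp_all
qed

lemma joint_cdf_swap: "joint_cdf M X Y x y = joint_cdf M Y X y x"
  by (simp add: joint_cdf_def conj_commute)

text \<open>The intersection of the two events lies in each of them, which gives the upper bound;
  inclusion-exclusion with a union of probability at most 1 gives the lower one.\<close>

lemma joint_cdf_bounds:
  assumes "prob_space M" "has_cdf M X F" "has_cdf M Y G"
  shows "frechet_lower F G x y \<le> joint_cdf M X Y x y"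
    and "joint_cdf M X Y x y \<le> frechet_upper F G x y"
proof -
  interpret prob_space M by fact
  have [measurable]: "X \<in> borel_measurable M" "Y \<in> borel_measurable M"
    using assms(2,3) by (simp_all add: has_cdf_def)
  define S T where "S = {\<omega> \<in> space M. X \<omega> \<le> x}" and "T = {\<omega> \<in> space M. Y \<omega> \<le> y}"
  have ST [measurable]: "S \<in> sets M" "T \<in> sets M"
    by (auto simp: S_def T_def)
  have "prob S = F x" "prob T = G y"
    using has_cdf_prob[OF assms(2)] has_cdf_prob[OF assms(3)] by (simp_all add: S_def T_def)
  moreover have "joint_cdf M X Y x y = prob (S \<inter> T)"
    unfolding joint_cdf_def S_def T_def by (rule arg_cong[where f = prob]) auto
  moreover have "prob (S \<inter> T) \<le> prob S" "prob (S \<inter> T) \<le> prob T"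
    by (auto intro!: finite_measure_mono)
  moreover have "prob (S \<union> T) = prob S + prob T - prob (S \<inter> T)"
    using measure_Un3[of S M T] ST by (simp add: fmeasurable_eq_sets)
  moreover have "prob (S \<union> T) \<le> 1" "0 \<le> prob (S \<inter> T)"
    by auto
  ultimately show "frechet_lower F G x y \<le> joint_cdf M X Y x y"
    and "joint_cdf M X Y x y \<le> frechet_upper F G x y"
    by (auto simp: frechet_lower_def frechet_upper_def)
qed

text \<open>The Frechet-Hoeffding bounds squeeze the joint cdf between \<open>F x + G y - 1\<close>
  and \<open>F x\<close>.\<close>

lemma joint_cdf_marginal:
  assumes "prob_space M" "has_cdf M X F" "has_cdf M Y G" "(G \<longlongrightarrow> 1) at_top"
  shows "(joint_cdf M X Y x \<longlongrightarrow> F x) at_top"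
proof (rule tendsto_sandwich)
  show "((\<lambda>y. F x + G y - 1) \<longlongrightarrow> F x) at_top"
    using tendsto_diff[OF tendsto_add[OF tendsto_const assms(4)] tendsto_const, of "F x" 1] by simp
  show "((\<lambda>y. F x) \<longlongrightarrow> F x) at_top"
    by simp
  show "\<forall>\<^sub>F y in at_top. F x + G y - 1 \<le> joint_cdf M X Y x y"
    using joint_cdf_bounds(1)[OF assms(1-3), of x]
    by (intro always_eventually) (simp add: frechet_lower_def)
  show "\<forall>\<^sub>F y in at_top. joint_cdf M X Y x y \<le> F x"
    using joint_cdf_bounds(2)[OF assms(1-3), of x]
    by (intro always_eventually) (simp add: frechet_upper_def)
qed

lemma has_cdf_cdf:
  assumes "prob_space M" "X \<in> borel_measurable M"
  shows "has_cdf M X (cdf (distr M borel X))" "(cdf (distr M borel X) \<longlongrightarrow> 1) at_top"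
proof -
  interpret prob_space M by fact
  interpret D: real_distribution "distr M borel X"
    using assms(2) by auto
  show "has_cdf M X (cdf (distr M borel X))"
    using assms(2) by (simp add: has_cdf_def)
  show "(cdf (distr M borel X) \<longlongrightarrow> 1) at_top"
    by (rule D.cdf_lim_at_top_prob)
qed

section \<open>Couplings and Hoeffding's covariance identity\<close>

locale cdf_pair =
  fixes F G :: "real \<Rightarrow> real"
  assumes F: "is_cdf F" and G: "is_cdf G"
    and F_var: "finite_pos_variance F" and G_var: "finite_pos_variance G"
begin

text \<open>The underlying space is arbitrary, so the same notion covers plane laws, the product
  measure and the space on which the algorithm runs.\<close>

definition coupling :: "'w measure \<Rightarrow> ('w \<Rightarrow> real) \<Rightarrow> ('w \<Rightarrow> real) \<Rightarrow> bool" where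
  "coupling M X Y \<longleftrightarrow> prob_space M \<and> has_cdf M X F \<and> has_cdf M Y G"

lemma coupling_mult_integrable:
  "coupling M X Y \<Longrightarrow> integrable M (\<lambda>\<omega>. X \<omega> * Y \<omega>)"
  by (rule has_cdf_mult_integrable[where F = F and G = G])
     (simp_all add: coupling_def F G F_var G_var)

lemma coupling_cor:
  assumes "coupling M X Y"
  shows "cor M X Y = ((\<integral>\<omega>. X \<omega> * Y \<omega> \<partial>M) - cdf_mean F * cdf_mean G) / (cdf_sd F * cdf_sd G)"
  by (rule cor_eq) (use assms F G F_var G_var in \<open>simp_all add: coupling_def\<close>)

text \<open>The reference coupling that is subtracted in Hoeffding's identity.\<close>

lemma independent_coupling:
  defines "N \<equiv> interval_measure F \<Otimes>\<^sub>M interval_measure G"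
  shows "coupling N fst snd" "joint_cdf N fst snd x y = F x * G y"
    "(\<integral>p. fst p * snd p \<partial>N) = cdf_mean F * cdf_mean G"
proof -
  interpret F: real_distribution "interval_measure F"
    using F by (rule is_cdf_interval_measure)
  interpret G: real_distribution "interval_measure G"
    using G by (rule is_cdf_interval_measure)
  interpret P: pair_prob_space "interval_measure F" "interval_measure G" ..
  have box: "measure N (A \<times> B) = measure (interval_measure F) A * measure (interval_measure G) B"
    if "A \<in> sets borel" "B \<in> sets borel" for A B
    using that by (simp add: N_def measure_def G.emeasure_pair_measure_Times enn2real_mult)
  have FG: "measure (interval_measure F) {..s} = F s" "measure (interval_measure G) {..s} = G s" for s
    using is_cdf_interval_measure(2)[OF F] is_cdf_interval_measure(2)[OF G]
    by (simp_all add: cdf_def2[symmetric])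
  have sp: "space N = UNIV"
    by (simp add: N_def space_pair_measure)
  have 1: "{p. fst p \<le> s} = {..s} \<times> UNIV" "{p. snd p \<le> s} = UNIV \<times> {..s}"
    "{p. fst p \<le> s \<and> snd p \<le> t} = {..s} \<times> {..t}" for s t :: real
    by auto
  show c: "coupling N fst snd"
    unfolding coupling_def
  proof (intro conjI has_cdfI)
    show "prob_space N"
      unfolding N_def by unfold_locales
    show "fst \<in> borel_measurable N" "snd \<in> borel_measurable N"
      unfolding N_def by measurable
    show "measure N {p \<in> space N. fst p \<le> s} = F s" "measure N {p \<in> space N. snd p \<le> s} = G s" for s
      using F.prob_space G.prob_space by (simp_all add: sp 1 box FG)
  qed
  show "joint_cdf N fst snd x y = F x * G y"
    by (simp add: joint_cdf_def sp 1 box FG)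
  have "(\<integral>p. fst p * snd p \<partial>N) = (\<integral>x. \<integral>y. x * y \<partial>interval_measure G \<partial>interval_measure F)"
    using P.integral_fst'[of "\<lambda>p. fst p * snd p"] coupling_mult_integrable[OF c] by (simp add: N_def)
  then show "(\<integral>p. fst p * snd p \<partial>N) = cdf_mean F * cdf_mean G"
    by (simp add: cdf_mean_def)
qed

text \<open>Difference of the layer-cake formulas for the given and the independent coupling: the
  terms with \<open>k\<close> drop out.\<close>

lemma hoeffding_covariance_identity:
  assumes "coupling M X Y"
  shows "has_bochner_integral (lborel \<Otimes>\<^sub>M lborel) (\<lambda>(s, t). joint_cdf M X Y s t - F s * G t)
    ((\<integral>\<omega>. X \<omega> * Y \<omega> \<partial>M) - cdf_mean F * cdf_mean G)"
proof -
  let ?N = "interval_measure F \<Otimes>\<^sub>M interval_measure G"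
  have "prob_space M" "has_cdf M X F" "has_cdf M Y G"
    and N: "prob_space ?N" "has_cdf ?N fst F" "has_cdf ?N snd G"
    using assms independent_coupling(1) by (simp_all add: coupling_def)
  from has_bochner_integral_diff
    [OF cross_moment_by_joint_cdf[OF this(1-3) coupling_mult_integrable[OF assms]]
        cross_moment_by_joint_cdf[OF N coupling_mult_integrable[OF independent_coupling(1)]]]
  show ?thesis
    by (simp add: independent_coupling(2,3) case_prod_unfold)
qed

lemma cor_by_joint_cdf:
  assumes "coupling M X Y"
  shows "has_bochner_integral (lborel \<Otimes>\<^sub>M lborel) (\<lambda>(s, t). joint_cdf M X Y s t - F s * G t)
    (cor M X Y * (cdf_sd F * cdf_sd G))"
  using hoeffding_covariance_identity[OF assms] cdf_sd_pos[OF F_var] cdf_sd_pos[OF G_var]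
  by (simp add: coupling_cor[OF assms])

lemma cor_mono_joint_cdf:
  assumes "coupling M X Y" "coupling N X' Y'"
    and "\<And>x y. joint_cdf M X Y x y \<le> joint_cdf N X' Y' x y"
  shows "cor M X Y \<le> cor N X' Y'"
proof -
  note 1 = cor_by_joint_cdf[OF assms(1), unfolded has_bochner_integral_iff]
  note 2 = cor_by_joint_cdf[OF assms(2), unfolded has_bochner_integral_iff]
  have "cor M X Y * (cdf_sd F * cdf_sd G) \<le> cor N X' Y' * (cdf_sd F * cdf_sd G)"
    unfolding conjunct2[OF 1, symmetric] conjunct2[OF 2, symmetric]
    by (rule integral_mono[OF conjunct1[OF 1] conjunct1[OF 2]]) (auto simp: assms(3))
  then show ?thesis
    using cdf_sd_pos[OF F_var] cdf_sd_pos[OF G_var] by (simp add: mult_le_cancel_right)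
qed

text \<open>Mixing with the independent coupling multiplies the integrand of Hoeffding's identity by
  \<open>p\<close>, and the value of an integral is unique.\<close>

lemma cor_mixture:
  assumes "coupling M X Y" "coupling N X' Y'"
    and "\<And>x y. joint_cdf N X' Y' x y = p * joint_cdf M X Y x y + (1 - p) * F x * G y"
  shows "cor N X' Y' = p * cor M X Y"
proof -
  have "joint_cdf N X' Y' s t - F s * G t = p * (joint_cdf M X Y s t - F s * G t)" for s t
    by (simp add: assms(3) algebra_simps)
  then have "has_bochner_integral (lborel \<Otimes>\<^sub>M lborel) (\<lambda>(s, t). joint_cdf N X' Y' s t - F s * G t)
      (p * (cor M X Y * (cdf_sd F * cdf_sd G)))"
    using has_bochner_integral_mult_right[OF cor_by_joint_cdf[OF assms(1)], of p]
    by (simp add: case_prod_unfold)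
  with cor_by_joint_cdf[OF assms(2)]
  have "cor N X' Y' * (cdf_sd F * cdf_sd G) = p * (cor M X Y * (cdf_sd F * cdf_sd G))"
    by (rule has_bochner_integral_eq)
  then show ?thesis
    using cdf_sd_pos[OF F_var] cdf_sd_pos[OF G_var] by simp
qed

section \<open>The extremal correlations\<close>

text \<open>Only plane laws enter \<open>correlations\<close>, so the pair is replaced by its law on
  the plane. Marginals and cross moment survive the push-forward, and they determine the
  correlation.\<close>

lemma cor_in_correlations:
  assumes "coupling M X Y"
  shows "cor M X Y \<in> correlations F G"
proof -
  interpret prob_space M
    using assms by (simp add: coupling_def)
  have [measurable]: "X \<in> borel_measurable M" "Y \<in> borel_measurable M"
    using assms by (simp_all add: coupling_def has_cdf_def)
  define \<mu> where "\<mu> = distr M borel (\<lambda>\<omega>. (X \<omega>, Y \<omega>))"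
  have XY [measurable]: "(\<lambda>\<omega>. (X \<omega>, Y \<omega>)) \<in> M \<rightarrow>\<^sub>M borel"
    unfolding borel_prod[symmetric] by measurable
  have proj [measurable]: "fst \<in> borel \<rightarrow>\<^sub>M (borel :: real measure)" "snd \<in> borel \<rightarrow>\<^sub>M (borel :: real measure)"
    by (intro borel_measurable_continuous_onI continuous_intros)+
  have distr: "distr \<mu> borel fst = distr M borel X" "distr \<mu> borel snd = distr M borel Y"
    unfolding \<mu>_def by (subst distr_distr; simp add: comp_def)+
  have \<mu>: "coupling \<mu> fst snd"
    using assms prob_space_distr[OF XY] proj
    by (simp add: coupling_def has_cdf_def distr) (simp add: \<mu>_def)
  have "(\<integral>p. fst p * snd p \<partial>\<mu>) = (\<integral>\<omega>. X \<omega> * Y \<omega> \<partial>M)"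
    unfolding \<mu>_def by (simp add: integral_distr)
  then have "cor M X Y = cor \<mu> fst snd"
    by (simp add: coupling_cor[OF assms] coupling_cor[OF \<mu>])
  moreover have pd: "plane_distribution \<mu>"
    using \<mu> by (simp add: plane_distribution_def coupling_def) (simp add: \<mu>_def)
  moreover have "joint_cdf \<mu> fst snd \<in> bivariate_cdfs F G"
    unfolding bivariate_cdfs_def
  proof (intro CollectI conjI allI exI)
    show "plane_distribution \<mu>" "joint_cdf \<mu> fst snd = joint_cdf \<mu> fst snd"
      using pd by simp_all
    show "(joint_cdf \<mu> fst snd x \<longlongrightarrow> F x) at_top" for x
      by (rule joint_cdf_marginal[where G = G]) (use \<mu> G in \<open>simp_all add: coupling_def is_cdf_def\<close>)
    show "((\<lambda>x. joint_cdf \<mu> fst snd x y) \<longlongrightarrow> G y) at_top" for y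
      unfolding joint_cdf_swap[of \<mu> fst snd]
      by (rule joint_cdf_marginal[where G = F]) (use \<mu> F in \<open>simp_all add: coupling_def is_cdf_def\<close>)
  qed
  ultimately show ?thesis
    by (auto simp: correlations_def)
qed

text \<open>The definition fixes the marginals through limits of the joint cdf. The same limits are
  the cdfs of the coordinates, so uniqueness of limits turns the plane law into a coupling.\<close>

lemma correlationsE:
  assumes "r \<in> correlations F G"
  obtains \<mu> where "coupling \<mu> fst snd" "r = cor \<mu> fst snd"
proof -
  from assms obtain \<mu> where \<mu>: "r = cor \<mu> fst snd" "plane_distribution \<mu>"
    and lim: "\<And>x. (joint_cdf \<mu> fst snd x \<longlongrightarrow> F x) at_top"
      "\<And>y. ((\<lambda>x. joint_cdf \<mu> fst snd x y) \<longlongrightarrow> G y) at_top"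
    by (auto simp: correlations_def bivariate_cdfs_def)
  have p: "prob_space \<mu>" and s: "sets \<mu> = sets borel"
    using \<mu>(2) by (simp_all add: plane_distribution_def)
  have m: "fst \<in> borel_measurable \<mu>" "snd \<in> borel_measurable \<mu>"
    unfolding measurable_cong_sets[OF s refl]
    by (intro borel_measurable_continuous_onI continuous_intros)+
  note c = has_cdf_cdf[OF p m(1)] has_cdf_cdf[OF p m(2)]
  have "cdf (distr \<mu> borel fst) x = F x" for x
    using joint_cdf_marginal[OF p c(1,3,4), of x] lim(1)[of x]
    by (rule tendsto_unique[OF trivial_limit_at_top_linorder])
  moreover have "cdf (distr \<mu> borel snd) y = G y" for y
    using joint_cdf_marginal[OF p c(3,1,2), of y] lim(2)[of y]
    unfolding joint_cdf_swap[of \<mu> fst snd]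
    by (rule tendsto_unique[OF trivial_limit_at_top_linorder])
  ultimately have "coupling \<mu> fst snd"
    using p m by (simp add: coupling_def has_cdf_def fun_eq_iff)
  then show thesis
    using \<mu>(1) that by blast
qed

text \<open>The upper Frechet bound dominates every joint cdf with these marginals, and correlation
  is monotone in the joint cdf. Attainment makes the \<open>GREATEST\<close> in
  \<open>rho_max\<close> well defined.\<close>

lemma rho_max_eq:
  assumes "coupling M X Y" "joint_cdf M X Y = frechet_upper F G"
  shows "rho_max F G = cor M X Y"
  unfolding rho_max_def
proof (rule Greatest_equality)
  show "cor M X Y \<in> correlations F G"
    using assms(1) by (rule cor_in_correlations)
  fix r assume "r \<in> correlations F G"
  then obtain \<mu> where \<mu>: "coupling \<mu> fst snd" "r = cor \<mu> fst snd"
    by (rule correlationsE)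
  show "r \<le> cor M X Y"
    unfolding \<mu>(2)
    by (rule cor_mono_joint_cdf[OF \<mu>(1) assms(1)])
       (use \<mu>(1) joint_cdf_bounds(2)[of \<mu> fst F snd G] in \<open>simp add: assms(2) coupling_def\<close>)
qed

text \<open>Dual to \<open>rho_max_eq\<close>: the lower Frechet bound lies below every competing
  joint cdf.\<close>

lemma rho_min_eq:
  assumes "coupling M X Y" "joint_cdf M X Y = frechet_lower F G"
  shows "rho_min F G = cor M X Y"
  unfolding rho_min_def
proof (rule Least_equality)
  show "cor M X Y \<in> correlations F G"
    using assms(1) by (rule cor_in_correlations)
  fix r assume "r \<in> correlations F G"
  then obtain \<mu> where \<mu>: "coupling \<mu> fst snd" "r = cor \<mu> fst snd"
    by (rule correlationsE)
  show "cor M X Y \<le> r"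
    unfolding \<mu>(2)
    by (rule cor_mono_joint_cdf[OF assms(1) \<mu>(1)])
       (use \<mu>(1) joint_cdf_bounds(1)[of \<mu> fst F snd G] in \<open>simp add: assms(2) coupling_def\<close>)
qed

end

section \<open>Non-degeneracy and strict signs of the extremal correlations\<close>

text \<open>If F only takes the values 0 and 1, then \<open>F (min s t) = F s * F t\<close>, so Hoeffding's identity for
  the comonotone pair (X, X) gives variance 0.\<close>

lemma nondegenerate_cdf:
  assumes F: "is_cdf F" and v: "finite_pos_variance F"
  shows "\<exists>s. 0 < F s \<and> F s < 1"
proof (rule ccontr)
  assume "\<not> ?thesis"
  then have 01: "F s = 0 \<or> F s = 1" for s
    using is_cdf_bounds[OF F, of s] by (auto simp: less_le)
  interpret cdf_pair F F
    by unfold_locales fact+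
  let ?N = "interval_measure F"
  interpret N: real_distribution ?N
    using F by (rule is_cdf_interval_measure)
  have N: "coupling ?N (\<lambda>x. x) (\<lambda>x. x)"
    using has_cdf_interval_measure[OF F] prob_space_interval_measure[OF F] by (simp add: coupling_def)
  have "joint_cdf ?N (\<lambda>x. x) (\<lambda>x. x) s t = F (min s t)" for s t
    using has_cdf_prob[OF has_cdf_interval_measure[OF F], of "min s t"] by (simp add: joint_cdf_def)
  also have "F (min s t) = F s * F t" for s t
    using 01[of s] 01[of t] monoD[of F s t] monoD[of F t s] F
    by (cases "s \<le> t") (auto simp: is_cdf_def min_def)
  finally have "(\<integral>x. x * x \<partial>?N) = cdf_mean F * cdf_mean F"
    using has_bochner_integral_integral_eq[OF hoeffding_covariance_identity[OF N]]
    by (simp add: case_prod_unfold)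
  then have "cdf_var F = 0"
    using N.variance_eq[of "\<lambda>x. x"] has_cdf_imp_integrable[OF _ F has_cdf_interval_measure[OF F] v] v
      prob_space_interval_measure[OF F]
    by (simp add: cdf_var_def cdf_mean_def finite_pos_variance_def power2_eq_square)
  with v show False
    by (simp add: finite_pos_variance_def)
qed

text \<open>Right-continuity keeps \<open>F\<close> below 1 just to the right of a non-degenerate
  point, and monotonicity keeps it positive there. An interval of positive length is wanted because
  a single point is Lebesgue-null.\<close>

lemma nondegenerate_cdf_interval:
  assumes F: "is_cdf F" and v: "finite_pos_variance F"
  obtains a b where "a < b" "\<And>s. a < s \<Longrightarrow> s < b \<Longrightarrow> 0 < F s \<and> F s < 1"
proof -
  obtain a where a: "0 < F a" "F a < 1"
    using nondegenerate_cdf[OF assms] by blast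
  have "(F \<longlongrightarrow> F a) (at_right a)"
    using F by (simp add: is_cdf_def continuous_within)
  then have "\<forall>\<^sub>F s in at_right a. F s < 1"
    using a(2) by (rule order_tendstoD)
  then obtain b where b: "a < b" "\<And>s. a < s \<Longrightarrow> s < b \<Longrightarrow> F s < 1"
    unfolding eventually_at_right_field by blast
  have "0 < F s" if "a < s" for s
    using a(1) monoD[of F a s] F that by (auto simp: is_cdf_def)
  with b show thesis
    by (intro that[of a b]) auto
qed

context cdf_pair
begin

text \<open>A nonnegative integrand with integral 0 vanishes almost everywhere, yet \<open>D\<close>
  is positive on a rectangle of positive area.\<close>

lemma integral_pos_if_pos_in_support:
  assumes v: "has_bochner_integral (lborel \<Otimes>\<^sub>M lborel) (\<lambda>(s, t). D s t) (v :: real)"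
    and nonneg: "\<And>s t. 0 \<le> D s t"
    and pos: "\<And>s t. 0 < F s \<Longrightarrow> F s < 1 \<Longrightarrow> 0 < G t \<Longrightarrow> G t < 1 \<Longrightarrow> 0 < D s t"
  shows "0 < v"
proof (rule ccontr)
  assume "\<not> 0 < v"
  let ?Q = "lborel \<Otimes>\<^sub>M (lborel :: real measure)"
  obtain a b where ab: "a < b" "\<And>s. a < s \<Longrightarrow> s < b \<Longrightarrow> 0 < F s \<and> F s < 1"
    using nondegenerate_cdf_interval[OF F F_var] by blast
  obtain c d where cd: "c < d" "\<And>s. c < s \<Longrightarrow> s < d \<Longrightarrow> 0 < G s \<and> G s < 1"
    using nondegenerate_cdf_interval[OF G G_var] by blast
  have i: "integrable ?Q (\<lambda>(s, t). D s t)" "integral\<^sup>L ?Q (\<lambda>(s, t). D s t) = v"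
    using v by (auto simp: has_bochner_integral_iff)
  have "0 \<le> v"
    unfolding i(2)[symmetric] using nonneg by (intro integral_nonneg_AE AE_I2) auto
  with \<open>\<not> 0 < v\<close> have "integral\<^sup>L ?Q (\<lambda>(s, t). D s t) = 0"
    using i(2) by simp
  then have "AE p in ?Q. (case p of (s, t) \<Rightarrow> D s t) = 0"
    using nonneg by (subst (asm) integral_nonneg_eq_0_iff_AE[OF i(1)]) auto
  then have "AE p in ?Q. p \<notin> {a<..<b} \<times> {c<..<d}"
    by eventually_elim (use ab(2) cd(2) pos in \<open>force\<close>)
  then have "emeasure ?Q ({a<..<b} \<times> {c<..<d}) = 0"
    by (subst (asm) AE_iff_measurable[OF _ refl]) (auto simp: space_pair_measure Collect_mem_eq)
  then show False
    using ab(1) cd(1) by (simp add: lborel.emeasure_pair_measure_Times)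
qed

text \<open>A product of two numbers in the closed unit interval is at most their minimum, and
  strictly smaller if both lie strictly inside.\<close>

lemma cor_upper_pos:
  assumes "coupling M X Y" "joint_cdf M X Y = frechet_upper F G"
  shows "0 < cor M X Y"
proof -
  have "0 < cor M X Y * (cdf_sd F * cdf_sd G)"
  proof (rule integral_pos_if_pos_in_support[OF cor_by_joint_cdf[OF assms(1)]])
    fix s t
    have FG: "0 \<le> F s" "F s \<le> 1" "0 \<le> G t" "G t \<le> 1"
      using is_cdf_bounds F G by auto
    then show "0 \<le> joint_cdf M X Y s t - F s * G t"
      by (auto simp: assms(2) frechet_upper_def min_def intro: mult_left_le mult_left_le_one_le
          order_trans[OF mult_left_le_one_le])
    assume "0 < F s" "F s < 1" "0 < G t" "G t < 1"
    then show "0 < joint_cdf M X Y s t - F s * G t"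
      by (simp add: assms(2) frechet_upper_def)
  qed
  then show ?thesis
    by (rule zero_less_mult_pos2) (simp add: cdf_sd_pos F_var G_var)
qed

text \<open>The sign of Hoeffding's integrand is flipped to reuse the positivity criterion. Against
  the two arguments of \<open>max\<close> in the lower bound, the differences are
  \<open>F s * G t\<close> and \<open>(1 - F s) * (1 - G t)\<close>.\<close>

lemma cor_lower_neg:
  assumes "coupling M X Y" "joint_cdf M X Y = frechet_lower F G"
  shows "cor M X Y < 0"
proof -
  have "has_bochner_integral (lborel \<Otimes>\<^sub>M lborel) (\<lambda>(s, t). F s * G t - joint_cdf M X Y s t)
      (- (cor M X Y * (cdf_sd F * cdf_sd G)))"
    using has_bochner_integral_minus[OF cor_by_joint_cdf[OF assms(1)]] by (simp add: case_prod_unfold)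
  then have "0 < - (cor M X Y * (cdf_sd F * cdf_sd G))"
  proof (rule integral_pos_if_pos_in_support)
    fix s t
    have factor: "F s * G t - (F s + G t - 1) = (1 - F s) * (1 - G t)"
      by (simp add: algebra_simps)
    have "0 \<le> F s * G t" "0 \<le> (1 - F s) * (1 - G t)"
      using is_cdf_bounds F G by auto
    then show "0 \<le> F s * G t - joint_cdf M X Y s t"
      unfolding assms(2) frechet_lower_def factor[symmetric] by linarith
    assume "0 < F s" "F s < 1" "0 < G t" "G t < 1"
    then have "0 < F s * G t" "0 < (1 - F s) * (1 - G t)"
      by simp_all
    then show "0 < F s * G t - joint_cdf M X Y s t"
      unfolding assms(2) frechet_lower_def factor[symmetric] by linarith
  qed
  then show ?thesis
    using cdf_sd_pos[OF F_var] cdf_sd_pos[OF G_var] by (simp add: mult_less_0_iff zero_less_mult_iff)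
qed

end

section \<open>Uniform variables and quantile transforms\<close>

lemma space_unif01 [simp]: "space unif01 = {0<..<1}"
  by (simp add: unif01_def space_restrict_space)

lemma sets_unif01: "A \<in> sets unif01 \<longleftrightarrow> A \<in> sets borel \<and> A \<subseteq> {0<..<1}"
  by (auto simp: unif01_def sets_restrict_space_iff)

lemma measure_unif01: "A \<in> sets unif01 \<Longrightarrow> measure unif01 A = measure lborel A"
  by (simp add: unif01_def measure_restrict_space sets_unif01[unfolded unif01_def])

lemma prob_space_unif01: "prob_space unif01"
  by (intro prob_spaceI) (simp add: unif01_def space_restrict_space emeasure_restrict_space)

lemma reflection_measurable_unif01: "(\<lambda>u. 1 - u) \<in> unif01 \<rightarrow>\<^sub>M unif01"
  unfolding unif01_def by (intro measurable_restrict_space3) auto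

text \<open>Inherited from Lebesgue measure on the line, which is invariant under negation and
  translation.\<close>

lemma distr_reflection_unif01: "distr unif01 unif01 (\<lambda>u. 1 - u) = unif01"
proof (rule measure_eqI)
  fix A assume "A \<in> sets (distr unif01 unif01 (\<lambda>u. 1 - u))"
  then have A: "A \<in> sets unif01" "A \<in> sets borel" "A \<subseteq> {0<..<1}"
    by (simp_all add: sets_unif01)
  have "distr lborel borel (\<lambda>u. 1 - u) = distr (distr lborel borel uminus) borel (\<lambda>u::real. 1 + u)"
    by (subst distr_distr) (auto simp: comp_def)
  then have l: "distr lborel borel (\<lambda>u. 1 - u) = (lborel :: real measure)"
    by (simp add: lborel_distr_uminus lborel_distr_plus)
  have "emeasure (distr unif01 unif01 (\<lambda>u. 1 - u)) A = emeasure unif01 ((\<lambda>u. 1 - u) -` A)"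
    using A(1,3) by (subst emeasure_distr[OF reflection_measurable_unif01])
      (auto intro!: arg_cong[where f = "emeasure unif01"])
  also have "\<dots> = emeasure lborel ((\<lambda>u. 1 - u) -` A)"
    using A(3) by (auto simp: unif01_def intro!: emeasure_restrict_space)
  also have "\<dots> = emeasure (distr lborel borel (\<lambda>u. 1 - u)) A"
    using A(2) by (subst emeasure_distr) auto
  also have "\<dots> = emeasure unif01 A"
    unfolding l using A by (simp add: unif01_def emeasure_restrict_space)
  finally show "emeasure (distr unif01 unif01 (\<lambda>u. 1 - u)) A = emeasure unif01 A" .
qed simp

lemma is_uniform_measure:
  assumes "is_uniform M U" "A \<in> sets unif01"
  shows "measure M (U -` A \<inter> space M) = measure unif01 A"
proof -
  have "measure (distr M unif01 U) A = measure M (U -` A \<inter> space M)"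
    using assms by (intro measure_distr) (simp_all add: is_uniform_def)
  then show ?thesis
    using assms(1) by (simp add: is_uniform_def)
qed

lemma is_uniform_range: "is_uniform M U \<Longrightarrow> \<omega> \<in> space M \<Longrightarrow> U \<omega> \<in> {0<..<1}"
  by (auto simp: is_uniform_def dest: measurable_space)

lemma is_uniform_reflection:
  assumes "is_uniform M U"
  shows "is_uniform M (\<lambda>\<omega>. 1 - U \<omega>)"
proof -
  have "distr M unif01 (\<lambda>\<omega>. 1 - U \<omega>) = distr (distr M unif01 U) unif01 (\<lambda>u. 1 - u)"
    using assms by (subst distr_distr) (auto simp: reflection_measurable_unif01 is_uniform_def comp_def)
  then show ?thesis
    using assms measurable_comp[OF _ reflection_measurable_unif01, of U M]
    by (simp add: is_uniform_def distr_reflection_unif01 comp_def)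
qed

lemma is_uniform_alg_U':
  assumes "is_uniform M U"
  shows "is_uniform M (alg_U' r U)"
  unfolding alg_U'_def[abs_def] using assms is_uniform_reflection[OF assms] by (cases "0 < r") simp_all

lemma has_cdf_uniform:
  assumes U: "is_uniform M U" and \<phi>: "has_cdf unif01 \<phi> F"
  shows "has_cdf M (\<lambda>\<omega>. \<phi> (U \<omega>)) F"
proof -
  have m: "U \<in> M \<rightarrow>\<^sub>M unif01" "\<phi> \<in> unif01 \<rightarrow>\<^sub>M borel" and d: "distr M unif01 U = unif01"
    using assms by (simp_all add: is_uniform_def has_cdf_def)
  have "distr M borel (\<lambda>\<omega>. \<phi> (U \<omega>)) = distr unif01 borel \<phi>"
    using distr_distr[OF m(2,1)] by (simp add: d comp_def)
  then show ?thesis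
    using \<phi> measurable_comp[OF m] by (simp add: has_cdf_def comp_def)
qed

text \<open>Galois connection between a cdf and its quantile function: by right-continuity the
  infimum is attained. It turns events about inverse cdfs into events about
  \<open>U\<close>.\<close>

lemma inv_cdf_le_iff:
  assumes "is_cdf F" "u \<in> {0<..<1}"
  shows "inv_cdf F u \<le> x \<longleftrightarrow> u \<le> F x"
proof -
  interpret right_continuous_mono F 0 1
    using assms(1) by unfold_locales (auto simp: is_cdf_def)
  show ?thesis
    using pseudoinverse[of u x] assms(2) by (simp add: inv_cdf_def)
qed

text \<open>Both events are upper bounds on the same \<open>U\<close>, so together they say that
  \<open>U\<close> is at most the smaller of \<open>F x\<close> and \<open>G y\<close>.\<close>

lemma frechet_upper_attained:
  assumes F: "is_cdf F" and G: "is_cdf G" and U: "is_uniform M U"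
    and \<phi>: "\<And>u. u \<in> {0<..<1} \<Longrightarrow> \<phi> u = inv_cdf F u"
    and \<psi>: "\<And>u. u \<in> {0<..<1} \<Longrightarrow> \<psi> u = inv_cdf G u"
  shows "joint_cdf M (\<lambda>\<omega>. \<phi> (U \<omega>)) (\<lambda>\<omega>. \<psi> (U \<omega>)) = frechet_upper F G"
proof (intro ext)
  fix x y
  define m where "m = min (F x) (G y)"
  have m: "0 \<le> m" "m \<le> 1"
    using is_cdf_bounds[OF F, of x] is_cdf_bounds[OF G, of y] by (auto simp: m_def)
  let ?A = "{0<..<1} \<inter> {..m}"
  have A: "?A \<in> sets unif01"
    by (auto simp: sets_unif01)
  have "{\<omega> \<in> space M. \<phi> (U \<omega>) \<le> x \<and> \<psi> (U \<omega>) \<le> y} = U -` ?A \<inter> space M"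
    using is_uniform_range[OF U]
    by (auto simp: \<phi> \<psi> inv_cdf_le_iff[OF F] inv_cdf_le_iff[OF G] m_def)
  then have "joint_cdf M (\<lambda>\<omega>. \<phi> (U \<omega>)) (\<lambda>\<omega>. \<psi> (U \<omega>)) x y = measure lborel ?A"
    by (simp only: joint_cdf_def is_uniform_measure[OF U A] measure_unif01[OF A])
  \<comment> \<open>For \<open>m = 1\<close> the right endpoint falls outside the open unit
    interval.\<close>
  also have "?A = (if m = 1 then {0<..<1} else {0<..m})"
    using m by auto
  also have "measure lborel \<dots> = m"
    using m by simp
  finally show "joint_cdf M (\<lambda>\<omega>. \<phi> (U \<omega>)) (\<lambda>\<omega>. \<psi> (U \<omega>)) x y = frechet_upper F G x y"
    by (simp add: frechet_upper_def m_def)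
qed

text \<open>With the reflected argument the second event bounds \<open>U\<close> from below by
  \<open>1 - G y\<close>, so \<open>U\<close> lies in an interval of length
  \<open>F x + G y - 1\<close>, or in the empty set.\<close>

lemma frechet_lower_attained:
  assumes F: "is_cdf F" and G: "is_cdf G" and U: "is_uniform M U"
    and \<phi>: "\<And>u. u \<in> {0<..<1} \<Longrightarrow> \<phi> u = inv_cdf F u"
    and \<psi>: "\<And>u. u \<in> {0<..<1} \<Longrightarrow> \<psi> u = inv_cdf G u"
  shows "joint_cdf M (\<lambda>\<omega>. \<phi> (U \<omega>)) (\<lambda>\<omega>. \<psi> (1 - U \<omega>)) = frechet_lower F G"
proof (intro ext)
  fix x y
  have b: "0 \<le> F x" "F x \<le> 1" "0 \<le> G y" "G y \<le> 1"
    using is_cdf_bounds F G by auto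
  let ?A = "{0<..<1} \<inter> {1 - G y..F x}"
  have A: "?A \<in> sets unif01"
    by (auto simp: sets_unif01)
  have "\<phi> (U \<omega>) \<le> x \<and> \<psi> (1 - U \<omega>) \<le> y \<longleftrightarrow> U \<omega> \<in> ?A" if "\<omega> \<in> space M" for \<omega>
    using is_uniform_range[OF U that]
    by (auto simp: \<phi> \<psi> inv_cdf_le_iff[OF F] inv_cdf_le_iff[OF G])
  then have "{\<omega> \<in> space M. \<phi> (U \<omega>) \<le> x \<and> \<psi> (1 - U \<omega>) \<le> y} = U -` ?A \<inter> space M"
    by blast
  then have "joint_cdf M (\<lambda>\<omega>. \<phi> (U \<omega>)) (\<lambda>\<omega>. \<psi> (1 - U \<omega>)) x y = measure lborel ?A"
    by (simp only: joint_cdf_def is_uniform_measure[OF U A] measure_unif01[OF A])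
  \<comment> \<open>Only the endpoints 0 and 1 can be lost in the open unit interval, and they form
    a null set.\<close>
  also have "\<dots> = measure lborel {1 - G y..F x}"
  proof -
    have "AE u in lborel. u \<noteq> 0 \<and> u \<noteq> (1::real)"
      using AE_lborel_singleton[of 0] AE_lborel_singleton[of 1] by auto
    then have "AE u in lborel. u \<in> ?A \<longleftrightarrow> u \<in> {1 - G y..F x}"
      by eventually_elim (use b in auto)
    then show ?thesis
      by (intro measure_eq_AE) auto
  qed
  also have "\<dots> = frechet_lower F G x y"
    by (simp add: frechet_lower_def measure_def max_def)
  finally show "joint_cdf M (\<lambda>\<omega>. \<phi> (U \<omega>)) (\<lambda>\<omega>. \<psi> (1 - U \<omega>)) x y = frechet_lower F G x y" .
qed

section \<open>The output of the algorithm as a mixture\<close>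

lemma indep_uniform_triple:
  assumes "prob_space M" and U: "is_uniform M U" and V: "is_uniform M V" and W: "is_uniform M W"
    and ind: "prob_space.indep_vars M (\<lambda>_. unif01) (\<lambda>i. [U, V, W] ! i) {..<3}"
    and A: "A \<in> sets unif01" "B \<in> sets unif01" "C \<in> sets unif01"
  shows "measure M {\<omega> \<in> space M. U \<omega> \<in> A \<and> V \<omega> \<in> B \<and> W \<omega> \<in> C}
    = measure unif01 A * measure unif01 B * measure unif01 C"
proof -
  interpret prob_space M by fact
  have 3: "{..<3::nat} = {0, 1, 2}"
    by auto
  have "prob (\<Inter>i\<in>{..<3}. ([U, V, W] ! i) -` ([A, B, C] ! i) \<inter> space M)
      = (\<Prod>i<3. prob (([U, V, W] ! i) -` ([A, B, C] ! i) \<inter> space M))"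
    by (rule indep_varsD_finite[OF ind]) (auto simp: 3 A)
  also have "(\<Inter>i\<in>{..<3}. ([U, V, W] ! i) -` ([A, B, C] ! i) \<inter> space M)
      = {\<omega> \<in> space M. U \<omega> \<in> A \<and> V \<omega> \<in> B \<and> W \<omega> \<in> C}"
    by (auto simp: 3)
  finally show ?thesis
    using is_uniform_measure[OF U A(1)] is_uniform_measure[OF V A(2)] is_uniform_measure[OF W A(3)]
    by (simp add: 3)
qed

text \<open>The event splits according to the branch chosen by \<open>W\<close>. Each piece is a
  product event in \<open>U\<close>, \<open>V\<close>, \<open>W\<close>, so independence applies to
  it although both branches use the same \<open>U\<close>.\<close>

lemma mixture_prob:
  assumes M: "prob_space M" and U: "is_uniform M U" and V: "is_uniform M V" and W: "is_uniform M W"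
    and ind: "prob_space.indep_vars M (\<lambda>_. unif01) (\<lambda>i. [U, V, W] ! i) {..<3}"
    and p: "0 \<le> p" "p \<le> 1"
    and A: "A \<in> sets unif01" "B \<in> sets unif01" "C \<in> sets unif01"
  shows "measure M {\<omega> \<in> space M. if W \<omega> < p then U \<omega> \<in> A else U \<omega> \<in> B \<and> V \<omega> \<in> C}
    = p * measure unif01 A + (1 - p) * (measure unif01 B * measure unif01 C)"
proof -
  interpret prob_space M by fact
  have m [measurable]: "U \<in> M \<rightarrow>\<^sub>M unif01" "V \<in> M \<rightarrow>\<^sub>M unif01" "W \<in> M \<rightarrow>\<^sub>M unif01"
    using U V W by (simp_all add: is_uniform_def)
  \<comment> \<open>The point 0 is removed from \<open>?Q\<close> so that it stays inside the open
    unit interval when \<open>p = 0\<close>; \<open>W\<close> never takes that value.\<close>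
  let ?I = "{0<..<1::real}" and ?P = "{0<..<p}" and ?Q = "{p..<1} - {0}"
  have PQ: "?I \<in> sets unif01" "?P \<in> sets unif01" "?Q \<in> sets unif01"
    using p by (auto simp: sets_unif01)
  have mI: "measure unif01 ?I = 1" and mP: "measure unif01 ?P = p"
    using p by (simp_all add: measure_unif01 PQ)
  have "?Q \<inter> ?P = {}" "?Q \<union> ?P = ?I"
    using p by auto
  then have mQ: "measure unif01 ?Q = 1 - p"
    using PQ finite_measure.finite_measure_Union[of unif01 ?Q ?P] prob_space_unif01 mI mP
    by (simp add: prob_space_def)
  have r: "U \<omega> \<in> ?I" "V \<omega> \<in> ?I" "W \<omega> \<in> ?I" if "\<omega> \<in> space M" for \<omega>
    using that is_uniform_range U V W by metis+
  then have "W \<omega> \<noteq> 0" if "\<omega> \<in> space M" for \<omega>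
    using that by force
  note r = r this
  define S where "S = {\<omega> \<in> space M. U \<omega> \<in> A \<and> V \<omega> \<in> ?I \<and> W \<omega> \<in> ?P}"
  define T where "T = {\<omega> \<in> space M. U \<omega> \<in> B \<and> V \<omega> \<in> C \<and> W \<omega> \<in> ?Q}"
  have "{\<omega> \<in> space M. if W \<omega> < p then U \<omega> \<in> A else U \<omega> \<in> B \<and> V \<omega> \<in> C} = S \<union> T"
    using r by (auto simp: S_def T_def)
  moreover have "S \<inter> T = {}"
    by (auto simp: S_def T_def)
  moreover have "S \<in> sets M" "T \<in> sets M"
    unfolding S_def T_def using A PQ by measurable
  ultimately have "prob {\<omega> \<in> space M. if W \<omega> < p then U \<omega> \<in> A else U \<omega> \<in> B \<and> V \<omega> \<in> C} = prob S + prob T"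
    by (simp add: finite_measure_Union)
  also have "prob S = measure unif01 A * p"
    unfolding S_def indep_uniform_triple[OF M U V W ind A(1) PQ(1,2)] by (simp add: mI mP)
  also have "prob T = measure unif01 B * measure unif01 C * (1 - p)"
    unfolding T_def indep_uniform_triple[OF M U V W ind A(2,3) PQ(3)] by (simp add: mQ)
  finally show ?thesis
    by simp
qed

text \<open>The map \<tau> stands for the identity or the reflection chosen by the algorithm. In the
  first branch the event concerns \<open>U\<close> alone; in the second, \<open>U\<close> and
  \<open>V\<close> separately. The marginal of \<open>Y\<close> mixes \<open>G\<close> with
  itself.\<close>

lemma mixture_joint_cdf:
  assumes M: "prob_space M" and U: "is_uniform M U" and V: "is_uniform M V" and W: "is_uniform M W"
    and ind: "prob_space.indep_vars M (\<lambda>_. unif01) (\<lambda>i. [U, V, W] ! i) {..<3}"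
    and p: "0 \<le> p" "p \<le> 1"
    and \<phi>: "has_cdf unif01 \<phi> F" and \<psi>: "has_cdf unif01 \<psi> G"
    and \<tau>: "\<tau> \<in> unif01 \<rightarrow>\<^sub>M unif01" and \<tau>U: "is_uniform M (\<lambda>\<omega>. \<tau> (U \<omega>))"
  defines "Y \<equiv> \<lambda>\<omega>. if W \<omega> < p then \<psi> (\<tau> (U \<omega>)) else \<psi> (V \<omega>)"
  shows "joint_cdf M (\<lambda>\<omega>. \<phi> (U \<omega>)) Y x y
      = p * joint_cdf M (\<lambda>\<omega>. \<phi> (U \<omega>)) (\<lambda>\<omega>. \<psi> (\<tau> (U \<omega>))) x y + (1 - p) * F x * G y"
    and "has_cdf M Y G"
proof -
  have m [measurable]: "U \<in> M \<rightarrow>\<^sub>M unif01" "V \<in> M \<rightarrow>\<^sub>M unif01" "W \<in> M \<rightarrow>\<^sub>M unif01"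
    "\<phi> \<in> borel_measurable unif01" "\<psi> \<in> borel_measurable unif01" "\<tau> \<in> unif01 \<rightarrow>\<^sub>M unif01"
    using U V W \<phi> \<psi> \<tau> by (simp_all add: is_uniform_def has_cdf_def)
  have r: "U \<omega> \<in> space unif01" "V \<omega> \<in> space unif01" if "\<omega> \<in> space M" for \<omega>
    unfolding space_unif01 using that is_uniform_range U V by metis+
  let ?S = "{u \<in> space unif01. \<phi> u \<le> x \<and> \<psi> (\<tau> u) \<le> y}"
  have sets: "?S \<in> sets unif01" "{u \<in> space unif01. \<phi> u \<le> x} \<in> sets unif01"
    by measurable
  have \<psi>_sets: "{u \<in> space unif01. \<psi> u \<le> t} \<in> sets unif01" "{u \<in> space unif01. \<psi> (\<tau> u) \<le> t} \<in> sets unif01" for t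
    by measurable
  have "{\<omega> \<in> space M. \<phi> (U \<omega>) \<le> x \<and> Y \<omega> \<le> y}
      = {\<omega> \<in> space M. if W \<omega> < p then U \<omega> \<in> ?S
          else U \<omega> \<in> {u \<in> space unif01. \<phi> u \<le> x} \<and> V \<omega> \<in> {u \<in> space unif01. \<psi> u \<le> y}}"
    using r by (auto simp: Y_def split: if_splits)
  moreover have "measure unif01 ?S = joint_cdf M (\<lambda>\<omega>. \<phi> (U \<omega>)) (\<lambda>\<omega>. \<psi> (\<tau> (U \<omega>))) x y"
    unfolding joint_cdf_def is_uniform_measure[OF U sets(1), symmetric]
    using r by (intro arg_cong[where f = "measure M"]) auto
  ultimately show "joint_cdf M (\<lambda>\<omega>. \<phi> (U \<omega>)) Y x y
      = p * joint_cdf M (\<lambda>\<omega>. \<phi> (U \<omega>)) (\<lambda>\<omega>. \<psi> (\<tau> (U \<omega>))) x y + (1 - p) * F x * G y"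
    using mixture_prob[OF M U V W ind p sets \<psi>_sets(1)[of y]]
    by (simp only: joint_cdf_def has_cdf_prob[OF \<phi>] has_cdf_prob[OF \<psi>] mult.assoc)
  show "has_cdf M Y G"
  proof (rule has_cdfI)
    have "W \<in> borel_measurable M"
      using measurable_compose[OF m(3), of "\<lambda>x. x" borel]
      by (simp add: unif01_def measurable_restrict_space1)
    then show "Y \<in> borel_measurable M"
      unfolding Y_def by measurable
    fix t
    \<comment> \<open>The same splitting with no constraint on \<open>U\<close> in the second
      branch.\<close>
    have "{\<omega> \<in> space M. Y \<omega> \<le> t}
      = {\<omega> \<in> space M. if W \<omega> < p then U \<omega> \<in> {u \<in> space unif01. \<psi> (\<tau> u) \<le> t}
          else U \<omega> \<in> space unif01 \<and> V \<omega> \<in> {u \<in> space unif01. \<psi> u \<le> t}}"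
      using r by (auto simp: Y_def split: if_splits)
    moreover have "measure unif01 {u \<in> space unif01. \<psi> (\<tau> u) \<le> t} = G t"
    proof -
      have "{\<omega> \<in> space M. \<psi> (\<tau> (U \<omega>)) \<le> t} = U -` {u \<in> space unif01. \<psi> (\<tau> u) \<le> t} \<inter> space M"
        using r by auto
      then show ?thesis
        using has_cdf_prob[OF has_cdf_uniform[OF \<tau>U \<psi>], of t] is_uniform_measure[OF U \<psi>_sets(2)[of t]]
        by simp
    qed
    moreover have "measure unif01 (space unif01) = 1"
      by (rule prob_space.prob_space[OF prob_space_unif01])
    ultimately show "measure M {\<omega> \<in> space M. Y \<omega> \<le> t} = G t"
      using mixture_prob[OF M U V W ind p \<psi>_sets(2)[of t] sets.top \<psi>_sets(1)[of t]]
      by (simp only: has_cdf_prob[OF \<psi>]) (simp add: algebra_simps)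
  qed
qed

section \<open>Marginals, correlation and joint cdf of the algorithm's output\<close>

theorem mainTheorem1:
  fixes F G \<phi> \<psi> :: "real \<Rightarrow> real" and \<rho> :: real
    and M :: "'w measure" and U V W :: "'w \<Rightarrow> real"
  defines "c \<equiv> \<lambda>r. c_coef M F G \<phi> \<psi> U (alg_U' r U)"
    and "X \<equiv> alg_X \<phi> U"
    and "Y \<equiv> \<lambda>r. alg_Y M F G \<phi> \<psi> r U V W"
  assumes "is_cdf F" and "is_cdf G"
    and "finite_pos_variance F" and "finite_pos_variance G"
    and "\<rho> \<in> {rho_min F G .. rho_max F G}"
    and "has_cdf unif01 \<phi> F" and "has_cdf unif01 \<psi> G"
    and "prob_space M"
    and "is_uniform M U" and "is_uniform M V" and "is_uniform M W"
    and "prob_space.indep_vars M (\<lambda>_. unif01) (\<lambda>i. [U, V, W] ! i) {..<3}"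
  shows
    "((\<rho> = 0 \<or> 0 < \<rho> / c \<rho>) \<and> \<rho> / c \<rho> \<le> 1 \<longrightarrow>
        has_cdf M X F \<and> has_cdf M (Y \<rho>) G \<and> cor M X (Y \<rho>) = \<rho>)
     \<and>
     ((\<forall>u\<in>{0<..<1}. \<phi> u = inv_cdf F u) \<and> (\<forall>u\<in>{0<..<1}. \<psi> u = inv_cdf G u) \<longrightarrow>
        (0 \<le> \<rho> \<longrightarrow> (\<forall>x y. joint_cdf M X (Y \<rho>) x y =
            \<rho> / rho_max F G * frechet_upper F G x y + (1 - \<rho> / rho_max F G) * F x * G y)) \<and>
        (\<rho> \<le> 0 \<longrightarrow> (\<forall>x y. joint_cdf M X (Y \<rho>) x y =
            \<rho> / rho_min F G * frechet_lower F G x y + (1 - \<rho> / rho_min F G) * F x * G y)) \<and>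
        (\<forall>r\<in>{rho_min F G .. rho_max F G}.
            c r \<noteq> 0 \<and> 0 \<le> r / c r \<and> r / c r \<le> 1 \<and>
            has_cdf M X F \<and> has_cdf M (Y r) G \<and> cor M X (Y r) = r))"
proof -
  interpret cdf_pair F G
    using assms(4-7) by unfold_locales
  note F = assms(4) and G = assms(5) and \<rho> = assms(8) and \<phi> = assms(9) and \<psi> = assms(10)
  note M = assms(11) and U = assms(12) and V = assms(13) and W = assms(14) and ind = assms(15)
  \<comment> \<open>The partner of \<open>X\<close> before mixing: the value of \<open>Y r\<close>
    whenever the first branch is taken.\<close>
  define Z where "Z r = (\<lambda>\<omega>. \<psi> (alg_U' r U \<omega>))" for r
  have X: "X = (\<lambda>\<omega>. \<phi> (U \<omega>))"
    by (simp add: X_def alg_X_def fun_eq_iff)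
  have X_F: "has_cdf M X F"
    unfolding X using U \<phi> by (rule has_cdf_uniform)
  have Z: "coupling M X (Z r)" for r
    using M X_F has_cdf_uniform[OF is_uniform_alg_U'[OF U] \<psi>] by (simp add: coupling_def Z_def)
  have c: "cor M X (Z r) = c r" for r
    unfolding coupling_cor[OF Z] by (simp add: c_def c_coef_def X Z_def)
  have mixture: "joint_cdf M X (Y r) x y
        = r / c r * joint_cdf M X (Z r) x y + (1 - r / c r) * F x * G y"
      "has_cdf M (Y r) G"
    if p: "0 \<le> r / c r" "r / c r \<le> 1" for r x y
  proof -
    define \<tau> :: "real \<Rightarrow> real" where "\<tau> = (\<lambda>u. if 0 < r then u else 1 - u)"
    have \<tau>U: "alg_U' r U = (\<lambda>\<omega>. \<tau> (U \<omega>))"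
      by (auto simp: alg_U'_def \<tau>_def)
    have \<tau>: "\<tau> \<in> unif01 \<rightarrow>\<^sub>M unif01"
      by (cases "0 < r") (simp_all add: \<tau>_def reflection_measurable_unif01)
    have Y: "Y r = (\<lambda>\<omega>. if W \<omega> < r / c r then \<psi> (\<tau> (U \<omega>)) else \<psi> (V \<omega>))"
      unfolding Y_def c_def alg_Y_def[abs_def] by (intro ext) (simp add: fun_cong[OF \<tau>U])
    note mix = mixture_joint_cdf[OF M U V W ind p \<phi> \<psi> \<tau> is_uniform_alg_U'[OF U, of r, unfolded \<tau>U]]
    show "joint_cdf M X (Y r) x y
        = r / c r * joint_cdf M X (Z r) x y + (1 - r / c r) * F x * G y"
      unfolding Y X Z_def \<tau>U by (rule mix(1))
    show "has_cdf M (Y r) G"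
      unfolding Y by (rule mix(2))
  qed
  \<comment> \<open>The mixture has correlation \<open>r / c r * c r\<close>. The third condition
    excludes \<open>c r = 0\<close> with \<open>r\<close> nonzero, where the convention
    \<open>r / 0 = 0\<close> would satisfy the two bounds but give correlation 0.\<close>
  have cor_Y: "cor M X (Y r) = r" if "0 \<le> r / c r" "r / c r \<le> 1" "r = 0 \<or> c r \<noteq> 0" for r
  proof -
    have "coupling M X (Y r)"
      using M X_F mixture(2)[OF that(1,2)] by (simp add: coupling_def)
    from cor_mixture[OF Z this mixture(1)[OF that(1,2)]] show ?thesis
      using that(3) by (auto simp: c)
  qed
  show ?thesis
  proof (intro conjI impI allI ballI)
    assume a: "(\<rho> = 0 \<or> 0 < \<rho> / c \<rho>) \<and> \<rho> / c \<rho> \<le> 1"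
    \<comment> \<open>Strict positivity of the ratio rules out both \<open>c \<rho> = 0\<close>, by
      the convention for division by 0, and a negative threshold, for which the first branch would
      never be taken.\<close>
    then have "0 \<le> \<rho> / c \<rho>" "\<rho> = 0 \<or> c \<rho> \<noteq> 0"
      by auto
    with a show "has_cdf M X F" "has_cdf M (Y \<rho>) G" "cor M X (Y \<rho>) = \<rho>"
      using X_F mixture(2) cor_Y by blast+
  next
    assume "(\<forall>u\<in>{0<..<1}. \<phi> u = inv_cdf F u) \<and> (\<forall>u\<in>{0<..<1}. \<psi> u = inv_cdf G u)"
    then have inv: "\<phi> u = inv_cdf F u" "\<psi> u = inv_cdf G u" if "u \<in> {0<..<1}" for u
      using that by auto
    have upper: "joint_cdf M X (Z r) = frechet_upper F G" if "0 < r" for r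
      unfolding X Z_def alg_U'_def using that frechet_upper_attained[OF F G U inv] by simp
    have lower: "joint_cdf M X (Z r) = frechet_lower F G" if "r \<le> 0" for r
      unfolding X Z_def alg_U'_def using that frechet_lower_attained[OF F G U inv] by simp
    have c_pos: "c r = rho_max F G" "0 < rho_max F G" if "0 < r" for r
      using rho_max_eq[OF Z upper[OF that]] cor_upper_pos[OF Z upper[OF that]] by (simp_all add: c)
    have c_nonpos: "c r = rho_min F G" "rho_min F G < 0" if "r \<le> 0" for r
      using rho_min_eq[OF Z lower[OF that]] cor_lower_neg[OF Z lower[OF that]] by (simp_all add: c)
    \<comment> \<open>By the strict signs, \<open>c r\<close> is the extremal correlation on the
      side of \<open>r\<close>, so the ratio compares numbers of equal sign, with \<open>r\<close>
      the smaller in absolute value.\<close>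
    have applicable: "c r \<noteq> 0 \<and> 0 \<le> r / c r \<and> r / c r \<le> 1"
      if "r \<in> {rho_min F G .. rho_max F G}" for r
      using that c_pos[of r] c_nonpos[of r] by (cases "0 < r") (auto simp: field_simps)
    {
      \<comment> \<open>At \<open>\<rho> = 0\<close> the algorithm reflects \<open>U\<close>, so
        \<open>Z\<close> attains the lower bound rather than the upper one; the weight 0 makes both
        formulas the product \<open>F x * G y\<close>.\<close>
      fix x y assume "0 \<le> \<rho>"
      then show "joint_cdf M X (Y \<rho>) x y
          = \<rho> / rho_max F G * frechet_upper F G x y + (1 - \<rho> / rho_max F G) * F x * G y"
        using mixture(1)[of \<rho> x y] applicable[OF \<rho>] upper[of \<rho>] c_pos(1)[of \<rho>]
        by (cases "\<rho> = 0") auto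
    next
      fix x y assume "\<rho> \<le> 0"
      then show "joint_cdf M X (Y \<rho>) x y
          = \<rho> / rho_min F G * frechet_lower F G x y + (1 - \<rho> / rho_min F G) * F x * G y"
        using mixture(1)[of \<rho> x y] applicable[OF \<rho>] lower[of \<rho>] c_nonpos(1)[of \<rho>] by auto
    next
      fix r assume "r \<in> {rho_min F G .. rho_max F G}"
      then show "c r \<noteq> 0" "0 \<le> r / c r" "r / c r \<le> 1"
          "has_cdf M X F" "has_cdf M (Y r) G" "cor M X (Y r) = r"
        using applicable X_F mixture(2) cor_Y by blast+
    }
  qed
qed

end
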